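(* Let $Q$ be a bivariate quasi-copula and $\varepsilon>0$. Let $M(u,v)=\min\{u,v\}$. Then there exist bivariate quasi-copulas $A$ and $B$ such that $\|Q-A\|_\infty<\varepsilon$, $\|M-B\|_\infty<\varepsilon$, and $A$ is a shuffle of $B$.
   Context: $\|\cdot\|_\infty$ is the supremum norm on $[0,1]^2$. A bivariate quasi-copula is a function $A\colon[0,1]^2\to[0,1]$ such that $A(u,1)=u=A(1,u)$ for all $u\in[0,1]$, $A$ is increasing (non-decreasing) in each variable, and $|A(\mathbf{v})-A(\mathbf{u})|\le|v_1-u_1|+|v_2-u_2|$ for all $\mathbf{u},\mathbf{v}\in[0,1]^2$. A quasi-copula $Q$ induces a unique finitely-additive signed measure $\mu_Q$ on the algebra of finite disjoint unions of half-open boxes $(x_1,y_1]\times(x_2,y_2]\subseteq[0,1]^2$ such that $\mu_Q((x_1,y_1]\times(x_2,y_2])=Q(y_1,y_2)-Q(x_1,y_2)-Q(y_1,x_2)+Q(x_1,x_2)$. Shuffle: for $k\in\{1,2\}$ let $J_i^k=(a_{i-1}^k,a_i^k]$, $i=1,\dots,n_k$, be a partition of $(0,1]$ with $0=a_0^k\le a_1^k\le\cdots\le a_{n_k}^k=1$, let $\pi_k$ be a permutation of $\{1,\dots,n_k\}$, and let $\phi_k\colon[0,1]\to[0,1]$ be given by $\phi_k(0)=0$ and $\phi_k(t)=t-a_{i-1}^k+\sum_{j:\,\pi_k(j)<\pi_k(i)}\lambda(J_j^k)$ for $t\in J_i^k$, where $\lambda$ is Lebesgue measure. Put $\phi(t_1,t_2)=(\phi_1(t_1),\phi_2(t_2))$.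 The function $(x_1,x_2)\mapsto\mu_Q\big(\phi^{-1}((0,x_1]\times(0,x_2])\big)$ on $[0,1]^2$ is called a shuffle of $Q$ (any choice of partitions and permutations is allowed; a shuffle of a quasi-copula need not be a quasi-copula). *)

theory Defs
  imports "HOL-Analysis.Analysis" "HOL-Combinatorics.Permutations"
begin

section \<open>Bivariate quasi-copulas\<close>

text \<open>
  Functions on the unit square are rendered as total functions on \<open>real \<times> real\<close>;
  nothing is required of their values outside the square.
\<close>

abbreviation unit_square :: "(real \<times> real) set" where
  "unit_square \<equiv> {0..1} \<times> {0..1}"

definition quasi_copula :: "(real \<times> real \<Rightarrow> real) \<Rightarrow> bool" where
  "quasi_copula A \<longleftrightarrow>
     A \<in> unit_square \<rightarrow> {0..1} \<and>
     (\<forall>u\<in>{0..1}. A (u, 1) = u \<and> A (1, u) = u) \<and>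
     (\<forall>v\<in>{0..1}. mono_on {0..1} (\<lambda>u. A (u, v)) \<and> mono_on {0..1} (\<lambda>u. A (v, u))) \<and>
     (\<forall>u\<in>unit_square. \<forall>v\<in>unit_square.
        \<bar>A v - A u\<bar> \<le> \<bar>fst v - fst u\<bar> + \<bar>snd v - snd u\<bar>)"

definition M_copula :: "real \<times> real \<Rightarrow> real" where
  "M_copula = (\<lambda>(u, v). min u v)"

text \<open>Only meaningful for functions that are bounded on the unit square.\<close>

definition sup_norm :: "(real \<times> real \<Rightarrow> real) \<Rightarrow> real" where
  "sup_norm f = (SUP p\<in>unit_square. \<bar>f p\<bar>)"


section \<open>The signed measure induced by a quasi-copula\<close>

definition half_open_boxes :: "(real \<times> real) set set" where
  "half_open_boxes = {{x1<..y1} \<times> {x2<..y2} | x1 y1 x2 y2.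
     0 \<le> x1 \<and> x1 \<le> y1 \<and> y1 \<le> 1 \<and> 0 \<le> x2 \<and> x2 \<le> y2 \<and> y2 \<le> 1}"

definition box_algebra :: "(real \<times> real) set set" where
  "box_algebra = {\<Union>F | F. finite F \<and> F \<subseteq> half_open_boxes \<and> disjoint F}"

definition induced_signed_measure ::
    "(real \<times> real \<Rightarrow> real) \<Rightarrow> ((real \<times> real) set \<Rightarrow> real) \<Rightarrow> bool" where
  "induced_signed_measure Q \<mu> \<longleftrightarrow>
     (\<forall>S\<in>box_algebra. \<forall>T\<in>box_algebra. S \<inter> T = {} \<longrightarrow> \<mu> (S \<union> T) = \<mu> S + \<mu> T) \<and>
     (\<forall>x1 y1 x2 y2.
        0 \<le> x1 \<and> x1 \<le> y1 \<and> y1 \<le> 1 \<and> 0 \<le> x2 \<and> x2 \<le> y2 \<and> y2 \<le> 1 \<longrightarrow>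
        \<mu> ({x1<..y1} \<times> {x2<..y2}) = Q (y1, y2) - Q (x1, y2) - Q (y1, x2) + Q (x1, x2))"

text \<open>
  The measure lives on \<^const>\<open>box_algebra\<close> only; extensionality pins down the irrelevant
  values elsewhere, so that the description is unique (see \<open>ex1_induced_signed_measure\<close> below).
\<close>

definition qc_measure :: "(real \<times> real \<Rightarrow> real) \<Rightarrow> (real \<times> real) set \<Rightarrow> real" where
  "qc_measure Q = (THE \<mu>. induced_signed_measure Q \<mu> \<and> \<mu> \<in> extensional box_algebra)"


subsection \<open>Existence and uniqueness\<close>

text \<open>
  Existence: the indicator of a set \<open>S\<close> of the algebra is a unique finite combination
  \<open>\<Sum>p. c p * indicator ({0<..fst p} \<times> {0<..snd p})\<close>, where \<open>c p\<close> is the mixed jump of the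
  indicator of \<open>S\<close> at \<open>p\<close>; the measure of \<open>S\<close> is then \<open>\<Sum>p. c p * Q p\<close>.
\<close>

definition mixed_diff :: "(real \<times> real) set \<Rightarrow> real \<times> real \<Rightarrow> real \<Rightarrow> real" where
  "mixed_diff S p h = indicator S p - indicator S (p + (h, 0)) - indicator S (p + (0, h))
     + indicator S (p + (h, h))"

definition has_jumps :: "(real \<times> real) set \<Rightarrow> (real \<times> real \<Rightarrow> real) \<Rightarrow> bool" where
  "has_jumps S c \<longleftrightarrow> finite {p. c p \<noteq> 0} \<and> (\<forall>p. \<forall>\<^sub>F h in at_right 0. mixed_diff S p h = c p)"

lemma has_jumps_unique:
  assumes "has_jumps S c" "has_jumps S d"
  shows "c = d"
proof
  fix p
  have "\<forall>\<^sub>F h in at_right 0. mixed_diff S p h = c p" "\<forall>\<^sub>F h in at_right 0. mixed_diff S p h = d p"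
    using assms unfolding has_jumps_def by blast+
  then have "\<forall>\<^sub>F h in at_right (0::real). c p = d p"
    by eventually_elim simp
  then show "c p = d p"
    by simp
qed

lemma has_jumps_Un:
  assumes "has_jumps S c" "has_jumps T d" "S \<inter> T = {}"
  shows "has_jumps (S \<union> T) (\<lambda>p. c p + d p)"
  unfolding has_jumps_def
proof (intro conjI allI)
  show "finite {p. c p + d p \<noteq> 0}"
    by (rule finite_subset[of _ "{p. c p \<noteq> 0} \<union> {p. d p \<noteq> 0}"])
       (use assms in \<open>auto simp: has_jumps_def\<close>)
  have eq: "mixed_diff (S \<union> T) p h = mixed_diff S p h + mixed_diff T p h" for p h
    unfolding mixed_diff_def by (simp add: indicator_add[OF assms(3), symmetric])
  fix p
  have "\<forall>\<^sub>F h in at_right 0. mixed_diff S p h = c p" "\<forall>\<^sub>F h in at_right 0. mixed_diff T p h = d p"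
    using assms unfolding has_jumps_def by blast+
  then show "\<forall>\<^sub>F h in at_right 0. mixed_diff (S \<union> T) p h = c p + d p"
    by eventually_elim (simp add: eq)
qed

lemma indicator_jump:
  fixes x y p :: real
  assumes "x \<le> y"
  shows "\<forall>\<^sub>F h in at_right 0. (indicator {x<..y} p - indicator {x<..y} (p + h) :: real)
           = of_bool (p = y) - of_bool (p = x)"
proof -
  define d where "d = min (if p < x then x - p else 1) (if p < y then y - p else 1)"
  have "d > 0" by (auto simp: d_def)
  then have "\<forall>\<^sub>F h in at_right 0. 0 < h \<and> h < d"
    by (auto simp: eventually_at_right_field)
  then show ?thesis
    by eventually_elim
       (use assms in \<open>cases "p < x"; cases "p = x"; cases "p < y"; cases "p = y";
          simp add: d_def indicator_def\<close>)
qed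

lemma has_jumps_box:
  fixes x1 y1 x2 y2 :: real
  assumes "x1 \<le> y1" "x2 \<le> y2"
  shows "has_jumps ({x1<..y1} \<times> {x2<..y2})
    (\<lambda>(p, q). (of_bool (p = y1) - of_bool (p = x1)) * (of_bool (q = y2) - of_bool (q = x2)))"
  unfolding has_jumps_def
proof (intro conjI allI)
  show "finite {p. (case p of (p, q) \<Rightarrow> (of_bool (p = y1) - of_bool (p = x1))
      * (of_bool (q = y2) - of_bool (q = x2))) \<noteq> (0::real)}"
    by (rule finite_subset[of _ "{x1, y1} \<times> {x2, y2}"]) (auto split: if_splits)
next
  fix pq :: "real \<times> real"
  obtain p q where pq: "pq = (p, q)" by fastforce
  have eq: "mixed_diff ({x1<..y1} \<times> {x2<..y2}) (p, q) h =
     (indicator {x1<..y1} p - indicator {x1<..y1} (p + h)) *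
     (indicator {x2<..y2} q - indicator {x2<..y2} (q + h))" for h
    unfolding mixed_diff_def by (simp add: indicator_times algebra_simps)
  show "\<forall>\<^sub>F h in at_right 0. mixed_diff ({x1<..y1} \<times> {x2<..y2}) pq h =
     (case pq of (p, q) \<Rightarrow> (of_bool (p = y1) - of_bool (p = x1))
      * (of_bool (q = y2) - of_bool (q = x2)))"
    using indicator_jump[OF assms(1), of p] indicator_jump[OF assms(2), of q]
    unfolding pq by eventually_elim (simp only: eq prod.case)
qed

lemma box_algebra_induct [consumes 1, case_names empty insert]:
  assumes "S \<in> box_algebra"
    and "P {}"
    and "\<And>B S. B \<in> half_open_boxes \<Longrightarrow> S \<in> box_algebra \<Longrightarrow> B \<inter> S = {} \<Longrightarrow> P S \<Longrightarrow> P (B \<union> S)"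
  shows "P S"
proof -
  obtain F where F: "finite F" "F \<subseteq> half_open_boxes" "disjoint F" "S = \<Union>F"
    using assms(1) unfolding box_algebra_def by auto
  have "P (\<Union>F)"
    using F(1-3)
  proof (induction F rule: finite_induct)
    case empty
    then show ?case using assms(2) by simp
  next
    case (insert B F)
    have disj: "disjoint F"
      using insert.prems(2) by (auto simp: disjoint_def)
    have "B \<inter> C = {}" if "C \<in> F" for C
      using disjointD[OF insert.prems(2), of B C] that insert.hyps(2) by auto
    then have "B \<inter> \<Union>F = {}"
      by blast
    moreover have "\<Union>F \<in> box_algebra"
      unfolding box_algebra_def using insert.hyps(1) insert.prems(1) disj by auto
    moreover have "P (\<Union>F)"
      by (rule insert.IH) (use insert.prems(1) disj in auto)
    moreover have "B \<in> half_open_boxes"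
      using insert.prems(1) by auto
    ultimately have "P (B \<union> \<Union>F)"
      by (intro assms(3))
    then show ?case
      by simp
  qed
  then show ?thesis using F(4) by simp
qed

lemma half_open_boxes_subset: "half_open_boxes \<subseteq> box_algebra"
proof
  fix B assume "B \<in> half_open_boxes"
  then show "B \<in> box_algebra"
    unfolding box_algebra_def by (auto intro!: exI[of _ "{B}"] simp: disjoint_def)
qed

lemma box_algebra_has_jumps:
  assumes "S \<in> box_algebra"
  shows "\<exists>c. has_jumps S c"
  using assms
proof (induction rule: box_algebra_induct)
  case empty
  have "has_jumps {} (\<lambda>_. 0)"
    by (auto simp: has_jumps_def mixed_diff_def)
  then show ?case by blast
next
  case (insert B S)
  obtain x1 y1 x2 y2 where "B = {x1<..y1} \<times> {x2<..y2}" "x1 \<le> y1" "x2 \<le> y2"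
    using insert.hyps(1) unfolding half_open_boxes_def by auto
  then obtain b where "has_jumps B b"
    using has_jumps_box by blast
  then show ?case
    using insert.IH has_jumps_Un insert.hyps(3) by blast
qed

theorem ex1_induced_signed_measure:
  "\<exists>!\<mu>. induced_signed_measure Q \<mu> \<and> \<mu> \<in> extensional box_algebra"
proof (rule ex_ex1I)
  define J where "J S = (THE c. has_jumps S c)" for S
  have J: "J S = c" if "has_jumps S c" for S c
    unfolding J_def by (rule the_equality, rule that) (rule has_jumps_unique[OF _ that])
  define m where "m S = (\<Sum>p | J S p \<noteq> 0. J S p * Q p)" for S
  have m: "m S = (\<Sum>p\<in>K. c p * Q p)"
    if "has_jumps S c" "finite K" "{p. c p \<noteq> 0} \<subseteq> K" for S c K
    unfolding m_def J[OF that(1)] by (rule sum.mono_neutral_left) (use that in auto)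
  define \<mu> where "\<mu> = restrict m box_algebra"
  have Un: "S \<union> T \<in> box_algebra" if ST: "S \<in> box_algebra" "T \<in> box_algebra" "S \<inter> T = {}" for S T
  proof -
    obtain F where F: "finite F" "F \<subseteq> half_open_boxes" "disjoint F" "S = \<Union>F"
      using ST(1) unfolding box_algebra_def by auto
    obtain G where G: "finite G" "G \<subseteq> half_open_boxes" "disjoint G" "T = \<Union>G"
      using ST(2) unfolding box_algebra_def by auto
    have "disjoint (F \<union> G)"
      using F(3,4) G(3,4) ST(3) by (intro disjoint_union) auto
    moreover have "S \<union> T = \<Union>(F \<union> G)"
      using F(4) G(4) by simp
    moreover have "finite (F \<union> G)" "F \<union> G \<subseteq> half_open_boxes"
      using F(1,2) G(1,2) by simp_all
    ultimately show ?thesis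
      unfolding box_algebra_def mem_Collect_eq by (intro exI[of _ "F \<union> G"] conjI)
  qed
  have "induced_signed_measure Q \<mu>"
    unfolding induced_signed_measure_def
  proof (intro conjI ballI allI impI)
    fix S T assume ST: "S \<in> box_algebra" "T \<in> box_algebra" "S \<inter> T = {}"
    obtain c d where c: "has_jumps S c" and d: "has_jumps T d"
      using box_algebra_has_jumps[OF ST(1)] box_algebra_has_jumps[OF ST(2)] by (elim exE)
    let ?K = "{p. c p \<noteq> 0} \<union> {p. d p \<noteq> 0}"
    have fin: "finite ?K"
      using c[unfolded has_jumps_def, THEN conjunct1] d[unfolded has_jumps_def, THEN conjunct1]
      by (rule finite_UnI)
    have "{p. c p + d p \<noteq> 0} \<subseteq> ?K"
      by (rule subsetI, rule ccontr) simp
    then have "m (S \<union> T) = (\<Sum>p\<in>?K. (c p + d p) * Q p)"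
      by (rule m[OF has_jumps_Un[OF c d ST(3)] fin])
    also have "\<dots> = m S + m T"
      unfolding m[OF c fin Un_upper1] m[OF d fin Un_upper2] distrib_right sum.distrib ..
    finally show "\<mu> (S \<union> T) = \<mu> S + \<mu> T"
      using ST Un by (simp add: \<mu>_def)
  next
    fix x1 y1 x2 y2 :: real
    assume *: "0 \<le> x1 \<and> x1 \<le> y1 \<and> y1 \<le> 1 \<and> 0 \<le> x2 \<and> x2 \<le> y2 \<and> y2 \<le> 1"
    let ?B = "{x1<..y1} \<times> {x2<..y2}"
    let ?a = "\<lambda>p. of_bool (p = y1) - of_bool (p = x1) :: real"
    let ?b = "\<lambda>q. of_bool (q = y2) - of_bool (q = x2) :: real"
    have "?B \<in> half_open_boxes" using * unfolding half_open_boxes_def by blast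
    then have "\<mu> ?B = m ?B" using half_open_boxes_subset by (auto simp: \<mu>_def)
    also have "\<dots> = (\<Sum>pq\<in>{x1, y1} \<times> {x2, y2}. (case pq of (p, q) \<Rightarrow> ?a p * ?b q) * Q pq)"
      by (rule m[OF has_jumps_box]) (use * in \<open>auto split: if_splits\<close>)
    also have "\<dots> = (\<Sum>p\<in>{x1, y1}. \<Sum>q\<in>{x2, y2}. ?a p * ?b q * Q (p, q))"
      by (simp add: sum.cartesian_product case_prod_unfold)
    also have "\<dots> = Q (y1, y2) - Q (x1, y2) - Q (y1, x2) + Q (x1, x2)"
      by (cases "x1 = y1"; cases "x2 = y2") auto
    finally show "\<mu> ?B = Q (y1, y2) - Q (x1, y2) - Q (y1, x2) + Q (x1, x2)" .
  qed
  moreover have "\<mu> \<in> extensional box_algebra" by (simp add: \<mu>_def)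
  ultimately show "\<exists>\<mu>. induced_signed_measure Q \<mu> \<and> \<mu> \<in> extensional box_algebra" by blast
next
  fix \<mu> \<nu>
  assume \<mu>: "induced_signed_measure Q \<mu> \<and> \<mu> \<in> extensional box_algebra"
    and \<nu>: "induced_signed_measure Q \<nu> \<and> \<nu> \<in> extensional box_algebra"
  have empty: "{} \<in> box_algebra" by (auto simp: box_algebra_def)
  have zero: "\<kappa> {} = 0" if "induced_signed_measure Q \<kappa>" for \<kappa>
  proof -
    have "\<kappa> ({} \<union> {}) = \<kappa> {} + \<kappa> {}"
      using that empty unfolding induced_signed_measure_def by (metis Int_empty_left)
    then show ?thesis by simp
  qed
  have "\<mu> S = \<nu> S" if "S \<in> box_algebra" for S
    using that
  proof (induction rule: box_algebra_induct)
    case empty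
    then show ?case using zero[of \<mu>] zero[of \<nu>] \<mu> \<nu> by simp
  next
    case (insert B S)
    have "\<mu> B = \<nu> B"
      using insert.hyps(1) \<mu> \<nu> unfolding half_open_boxes_def induced_signed_measure_def by auto
    have add: "\<kappa> (B \<union> S) = \<kappa> B + \<kappa> S" if "induced_signed_measure Q \<kappa>" for \<kappa>
    proof -
      have "B \<in> box_algebra"
        using insert.hyps(1) half_open_boxes_subset by blast
      then show ?thesis
        using that insert.hyps(2,3) unfolding induced_signed_measure_def by blast
    qed
    show ?case
      using add[of \<mu>] add[of \<nu>] \<mu> \<nu> insert.IH \<open>\<mu> B = \<nu> B\<close> by simp
  qed
  then show "\<mu> = \<nu>" using \<mu> \<nu> by (auto intro: extensionalityI)
qed


section \<open>Shuffles\<close>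

text \<open>Division points may coincide, so the pieces \<open>piece a i\<close> may be empty.\<close>

definition interval_partition :: "nat \<Rightarrow> (nat \<Rightarrow> real) \<Rightarrow> bool" where
  "interval_partition n a \<longleftrightarrow> a 0 = 0 \<and> a n = 1 \<and> (\<forall>i\<in>{1..n}. a (i - 1) \<le> a i)"

definition piece :: "(nat \<Rightarrow> real) \<Rightarrow> nat \<Rightarrow> real set" where
  "piece a i = {a (i - 1)<..a i}"

definition shuffle_map :: "nat \<Rightarrow> (nat \<Rightarrow> real) \<Rightarrow> (nat \<Rightarrow> nat) \<Rightarrow> real \<Rightarrow> real" where
  "shuffle_map n a \<pi> t =
     (if t = 0 then 0
      else let i = (THE i. i \<in> {1..n} \<and> t \<in> piece a i) in
        t - a (i - 1) + (\<Sum>j | j \<in> {1..n} \<and> \<pi> j < \<pi> i. measure lborel (piece a j)))"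

text \<open>\<open>is_shuffle A Q\<close>: the function \<open>A\<close> is, on the unit square, a shuffle of \<open>Q\<close>.\<close>

definition is_shuffle :: "(real \<times> real \<Rightarrow> real) \<Rightarrow> (real \<times> real \<Rightarrow> real) \<Rightarrow> bool" where
  "is_shuffle A Q \<longleftrightarrow>
     (\<exists>n1 n2 a1 a2 \<pi>1 \<pi>2.
        interval_partition n1 a1 \<and> interval_partition n2 a2 \<and>
        \<pi>1 permutes {1..n1} \<and> \<pi>2 permutes {1..n2} \<and>
        (\<forall>x1\<in>{0..1}. \<forall>x2\<in>{0..1}.
           A (x1, x2) = qc_measure Q
             {(t1, t2) \<in> unit_square.
                (shuffle_map n1 a1 \<pi>1 t1, shuffle_map n2 a2 \<pi>2 t2) \<in> {0<..x1} \<times> {0<..x2}}))"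

end

theory Submission
  imports Defs
begin

text \<open>
  Cut the unit interval into \<open>m\<close> columns of width \<open>1/m\<close>, each into \<open>m\<close> subcolumns of width
  \<open>1/m\<^sup>2\<close>. For \<open>k < m\<close> let \<open>X\<^sub>k\<close> be the union of the \<open>k\<close>-th subcolumns of all columns; it is a comb
  of total length \<open>1/m\<close>. Let \<open>A\<close> place a copy of \<open>Q\<close>, scaled by \<open>1/m\<close>, on each product
  \<open>X\<^sub>k \<times> X\<^sub>k\<close>, where \<open>X\<^sub>k\<close> is read as one interval by closing its gaps. Exchanging the roles of
  column and subcolumn permutes the \<open>m\<^sup>2\<close> pieces so that every \<open>X\<^sub>k\<close> becomes the interval
  \<open>(k/m, (k+1)/m]\<close>. The same permutation in both coordinates therefore turns \<open>A\<close> into the ordinal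
  sum \<open>B\<close> of \<open>m\<close> scaled copies of \<open>Q\<close> along the diagonal. Signed mass causes no trouble, because
  whole copies of \<open>Q\<close> are moved, negative mass included.

  Both functions are averages \<open>(\<Sum>k<m. Q (g k u, g k v)) / m\<close>, with different families of monotone
  maps \<open>g k\<close> of the unit interval to itself, in both cases with mean equal to the identity.
  Every such average is a quasi-copula (\<open>quasi_copula_average_pullback\<close>), since \<open>Q\<close> is monotone and
  Lipschitz. Both estimates are elementary: for \<open>A\<close> each \<open>g k\<close> is within
  \<open>1/m\<close> of the identity, so \<open>A\<close> is within \<open>2/m\<close> of \<open>Q\<close> (\<open>comb_average_near\<close>); for \<open>B\<close> at most one
  summand differs from the corresponding summand for \<open>M\<close>, so \<open>B\<close> is within \<open>1/m\<close> of \<open>M\<close>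
  (\<open>block_average_near_M\<close>).

  That \<open>A\<close> is a shuffle of \<open>B\<close> (\<open>comb_average_is_shuffle\<close>) reduces to one coordinate. The preimage
  of a box \<open>(0, x] \<times> (0, y]\<close> is a grid of disjoint boxes, and the \<open>B\<close>-measure of a grid is a double
  sum of differences. In either variable this sum telescopes (\<open>block_telescope\<close>): the parts of the
  preimage of \<open>(0, x]\<close> that lie in the \<open>k\<close>-th block are full intervals, then at most one partial
  interval, then empty ones, and after rescaling they join up to the interval from \<open>0\<close> to the
  compressed position of \<open>x\<close> in \<open>X\<^sub>k\<close>.
\<close>

section \<open>Averages of rescaled copies\<close>

definition average_pullback ::
    "nat \<Rightarrow> (nat \<Rightarrow> real \<Rightarrow> real) \<Rightarrow> (real \<times> real \<Rightarrow> real) \<Rightarrow> real \<times> real \<Rightarrow> real" where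
  "average_pullback m g Q = (\<lambda>(u, v). (\<Sum>k<m. Q (g k u, g k v)) / real m)"

lemma quasi_copulaD:
  assumes "quasi_copula Q" "u \<in> {0..1}" "v \<in> {0..1}"
  shows "Q (u, v) \<in> {0..1}"
    and "Q (u, 1) = u" and "Q (1, u) = u"
    and "\<And>u'. u \<le> u' \<Longrightarrow> u' \<le> 1 \<Longrightarrow> Q (u, v) \<le> Q (u', v)"
    and "\<And>v'. v \<le> v' \<Longrightarrow> v' \<le> 1 \<Longrightarrow> Q (u, v) \<le> Q (u, v')"
    and "\<And>u' v'. u' \<in> {0..1} \<Longrightarrow> v' \<in> {0..1} \<Longrightarrow> \<bar>Q (u', v') - Q (u, v)\<bar> \<le> \<bar>u' - u\<bar> + \<bar>v' - v\<bar>"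
proof -
  note Q = assms(1)[unfolded quasi_copula_def]
  show "Q (u, v) \<in> {0..1}" using Q assms(2,3) by blast
  show "Q (u, 1) = u" "Q (1, u) = u" using Q assms(2) by blast+
  show "Q (u, v) \<le> Q (u', v)" if "u \<le> u'" "u' \<le> 1" for u'
  proof -
    have "mono_on {0..1} (\<lambda>u. Q (u, v))" using Q assms(3) by blast
    from mono_onD[OF this, of u u'] show ?thesis using that assms(2) by simp
  qed
  show "Q (u, v) \<le> Q (u, v')" if "v \<le> v'" "v' \<le> 1" for v'
  proof -
    have "mono_on {0..1} (\<lambda>v. Q (u, v))" using Q assms(2) by blast
    from mono_onD[OF this, of v v'] show ?thesis using that assms(3) by simp
  qed
  show "\<bar>Q (u', v') - Q (u, v)\<bar> \<le> \<bar>u' - u\<bar> + \<bar>v' - v\<bar>" if "u' \<in> {0..1}" "v' \<in> {0..1}" for u' v'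
  proof -
    have "\<forall>p\<in>unit_square. \<forall>q\<in>unit_square. \<bar>Q q - Q p\<bar> \<le> \<bar>fst q - fst p\<bar> + \<bar>snd q - snd p\<bar>"
      using Q by blast
    then have "\<bar>Q (u', v') - Q (u, v)\<bar> \<le> \<bar>fst (u', v') - fst (u, v)\<bar> + \<bar>snd (u', v') - snd (u, v)\<bar>"
      using assms(2,3) that by blast
    then show ?thesis by simp
  qed
qed

lemma quasi_copula_zero:
  assumes "quasi_copula Q" "u \<in> {0..1}"
  shows "Q (u, 0) = 0" "Q (0, u) = 0"
proof -
  have "Q (u, 0) \<le> Q (1, 0)" "Q (0, u) \<le> Q (0, 1)"
    using quasi_copulaD(4)[OF assms(1), of u 0 1] quasi_copulaD(5)[OF assms(1), of 0 u 1] assms(2)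
    by auto
  moreover have "Q (1, 0) = 0" "Q (0, 1) = 0"
    using quasi_copulaD(2,3)[OF assms(1), of 0 0] by auto
  moreover have "Q (u, 0) \<ge> 0" "Q (0, u) \<ge> 0"
    using quasi_copulaD(1)[OF assms(1), of u 0] quasi_copulaD(1)[OF assms(1), of 0 u] assms(2)
    by auto
  ultimately show "Q (u, 0) = 0" "Q (0, u) = 0" by linarith+
qed

text \<open>
  Monotonicity of the maps turns the mean condition into an exact statement about distances: the
  mean of \<open>\<bar>g k u' - g k u\<bar>\<close> is \<open>\<bar>u' - u\<bar>\<close>. Hence the Lipschitz constant of the average is still
  \<open>1\<close>, although a single map \<open>g k\<close> may stretch distances by the factor \<open>m\<close>.
\<close>
lemma quasi_copula_average_pullback:
  assumes Q: "quasi_copula Q" and m: "m > 0"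
    and mono: "\<And>k u u'. k < m \<Longrightarrow> u \<le> u' \<Longrightarrow> g k u \<le> g k u'"
    and range: "\<And>k u. k < m \<Longrightarrow> u \<in> {0..1} \<Longrightarrow> g k u \<in> {0..1}"
    and one: "\<And>k. k < m \<Longrightarrow> g k 1 = 1"
    and avg: "\<And>u. u \<in> {0..1} \<Longrightarrow> (\<Sum>k<m. g k u) = real m * u"
  shows "quasi_copula (average_pullback m g Q)"
proof -
  let ?A = "average_pullback m g Q"
  have dist: "(\<Sum>k<m. \<bar>g k u' - g k u\<bar>) = real m * \<bar>u' - u\<bar>" if "u \<in> {0..1}" "u' \<in> {0..1}" for u u'
    using that
  proof (induction u u' rule: linorder_wlog)
    case (le u u')
    then have "(\<Sum>k<m. \<bar>g k u' - g k u\<bar>) = (\<Sum>k<m. g k u' - g k u)"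
      by (intro sum.cong) (use mono in auto)
    also have "\<dots> = real m * \<bar>u' - u\<bar>"
      using le avg[of u] avg[of u'] by (simp add: sum_subtractf right_diff_distrib)
    finally show ?case .
  qed (simp add: abs_minus_commute)
  have lip: "\<bar>?A (u', v') - ?A (u, v)\<bar> \<le> \<bar>u' - u\<bar> + \<bar>v' - v\<bar>"
    if uv: "u \<in> {0..1}" "v \<in> {0..1}" "u' \<in> {0..1}" "v' \<in> {0..1}" for u v u' v'
  proof -
    have "\<bar>(\<Sum>k<m. Q (g k u', g k v')) - (\<Sum>k<m. Q (g k u, g k v))\<bar>
        \<le> (\<Sum>k<m. \<bar>Q (g k u', g k v') - Q (g k u, g k v)\<bar>)"
      unfolding sum_subtractf[symmetric] by (rule sum_abs)
    also have "\<dots> \<le> (\<Sum>k<m. \<bar>g k u' - g k u\<bar> + \<bar>g k v' - g k v\<bar>)"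
      by (intro sum_mono quasi_copulaD(6)[OF Q] range uv) auto
    also have "\<dots> = real m * (\<bar>u' - u\<bar> + \<bar>v' - v\<bar>)"
      using uv by (simp add: sum.distrib dist distrib_left)
    finally show ?thesis
      using m by (simp add: average_pullback_def diff_divide_distrib[symmetric] field_simps)
  qed
  have bounds: "?A (u, v) \<in> {0..1}" if "u \<in> {0..1}" "v \<in> {0..1}" for u v
  proof -
    have *: "Q (g k u, g k v) \<in> {0..1}" if "k < m" for k
      using that \<open>u \<in> _\<close> \<open>v \<in> _\<close> by (intro quasi_copulaD(1)[OF Q] range)
    have "0 \<le> (\<Sum>k<m. Q (g k u, g k v))"
      by (intro sum_nonneg) (use * in auto)
    moreover have "(\<Sum>k<m. Q (g k u, g k v)) \<le> (\<Sum>k<m. 1)"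
      by (intro sum_mono) (use * in auto)
    ultimately show ?thesis using m by (simp add: average_pullback_def)
  qed
  have margins: "?A (u, 1) = u" "?A (1, u) = u" if "u \<in> {0..1}" for u
    using that m avg[of u] range quasi_copulaD(2,3)[OF Q]
    by (simp_all add: average_pullback_def one cong: sum.cong_simp)
  have mono1: "?A (u, v) \<le> ?A (u', v)" "?A (v, u) \<le> ?A (v, u')"
    if uv: "u \<in> {0..1}" "u' \<in> {0..1}" "u \<le> u'" "v \<in> {0..1}" for u u' v
  proof -
    have "Q (g k u, g k v) \<le> Q (g k u', g k v)" "Q (g k v, g k u) \<le> Q (g k v, g k u')" if "k < m" for k
      using quasi_copulaD(4)[OF Q range[OF that uv(1)] range[OF that uv(4)], of "g k u'"]
        quasi_copulaD(5)[OF Q range[OF that uv(4)] range[OF that uv(1)], of "g k u'"]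
        mono[OF that uv(3)] range[OF that uv(2)] by auto
    then show "?A (u, v) \<le> ?A (u', v)" "?A (v, u) \<le> ?A (v, u')"
      by (auto simp: average_pullback_def intro!: divide_right_mono sum_mono)
  qed
  show ?thesis
    unfolding quasi_copula_def
    using bounds margins mono1 lip by (auto intro!: mono_onI Pi_I)
qed

section \<open>Sums of clamped values\<close>

definition unit_clamp :: "real \<Rightarrow> real" where
  "unit_clamp x = max 0 (min 1 x)"

lemma unit_clamp_range: "0 \<le> unit_clamp x" "unit_clamp x \<le> 1"
  by (auto simp: unit_clamp_def)

lemma unit_clamp_mono: "x \<le> y \<Longrightarrow> unit_clamp x \<le> unit_clamp y"
  by (auto simp: unit_clamp_def)

text \<open>
  Here \<open>unit_clamp (s - i)\<close> is the length of \<open>{0..s} \<inter> {i..i + 1}\<close>.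
\<close>
lemma sum_unit_clamp:
  assumes "0 \<le> s"
  shows "(\<Sum>i<m. unit_clamp (s - real i)) = min s (real m)"
proof (induction m)
  case 0
  then show ?case using assms by simp
next
  case (Suc m)
  have "min s (real m) + unit_clamp (s - real m) = min s (real (Suc m))"
    unfolding unit_clamp_def min_def max_def by simp
  then show ?case using Suc by simp
qed

lemma sum_nat_blocks:
  fixes G :: "nat \<Rightarrow> 'a::comm_monoid_add"
  shows "(\<Sum>p<n*m. G p) = (\<Sum>k<n. \<Sum>i<m. G (k * m + i))"
proof -
  have "(\<Sum>p<n*m. G p) = (\<Sum>k<n. sum G {k*m..<k*m+m})"
    by (rule sum.nat_group[symmetric])
  also have "\<dots> = (\<Sum>k<n. \<Sum>i<m. G (k * m + i))"
    by (simp add: sum.atLeastLessThan_shift_0[of G] atLeast0LessThan)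
  finally show ?thesis .
qed

lemma sum_rotate:
  "(\<Sum>p\<in>I. \<Sum>q\<in>J. \<Sum>k\<in>K. G p q k) = (\<Sum>k\<in>K. \<Sum>p\<in>I. \<Sum>q\<in>J. G p q k)"
proof -
  have "(\<Sum>p\<in>I. \<Sum>q\<in>J. \<Sum>k\<in>K. G p q k) = (\<Sum>p\<in>I. \<Sum>k\<in>K. \<Sum>q\<in>J. G p q k)"
    by (intro sum.cong refl sum.swap)
  also have "\<dots> = (\<Sum>k\<in>K. \<Sum>p\<in>I. \<Sum>q\<in>J. G p q k)"
    by (rule sum.swap)
  finally show ?thesis .
qed

text \<open>
  Both approximation estimates rest on this: an error spread over \<open>m\<close> summands is supported on the
  one index \<open>\<lfloor>s\<rfloor>\<close>, so it does not grow with \<open>m\<close>.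
\<close>
lemma sum_at_most_one_term:
  fixes F :: "nat \<Rightarrow> real"
  assumes "\<And>i. i < m \<Longrightarrow> \<bar>F i\<bar> \<le> 1"
    and "\<And>i. i < m \<Longrightarrow> F i \<noteq> 0 \<Longrightarrow> real i \<le> s \<and> s < real i + 1"
  shows "\<bar>\<Sum>i<m. F i\<bar> \<le> 1"
proof (cases "\<exists>j<m. F j \<noteq> 0")
  case True
  then obtain j where j: "j < m" "F j \<noteq> 0" by blast
  have "F i = 0" if "i \<in> {..<m} - {j}" for i
  proof (rule ccontr)
    assume "F i \<noteq> 0"
    then show False
      using assms(2)[of i] assms(2)[OF j] that by force
  qed
  then have "(\<Sum>i<m. F i) = (\<Sum>i\<in>{j}. F i)"
    using j(1) by (intro sum.mono_neutral_right) simp_all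
  then show ?thesis using assms(1) j by simp
next
  case False
  then show ?thesis by simp
qed

text \<open>
  The second hypothesis makes \<open>z\<close> a run of ones, then at most one fractional value, then zeros. So
  the nonempty intervals from \<open>i\<close> to \<open>i + z i\<close> are adjacent, and end at the sum of the \<open>z i\<close>.
\<close>
lemma sum_staircase_telescope:
  fixes f :: "real \<Rightarrow> real" and z :: "nat \<Rightarrow> real"
  assumes "\<And>i. z i \<in> {0..1}" and "\<And>i. z (Suc i) > 0 \<Longrightarrow> z i = 1"
  shows "(\<Sum>i<m. f (real i + z i) - f (real i)) = f (\<Sum>i<m. z i) - f 0"
proof (induction m)
  case (Suc m)
  show ?case
  proof (cases "z m = 0")
    case True
    then show ?thesis using Suc by simp
  next
    case False
    then have "z m > 0" using assms(1)[of m] by simp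
    have ones: "z i = 1" if "i < m" for i
    proof -
      have "z i > 0" if "i \<le> m" for i
        using that
      proof (induction i rule: inc_induct)
        case base
        show ?case by (rule \<open>z m > 0\<close>)
      next
        case (step i)
        then show ?case using assms(2)[of i] by simp
      qed
      from this[of "Suc i"] show ?thesis using that assms(2)[of i] by simp
    qed
    then have "(\<Sum>i<m. z i) = real m" by simp
    then show ?thesis using Suc by simp
  qed
qed simp

section \<open>Block and comb coordinates\<close>

text \<open>
  Both maps are distribution functions of a uniform distribution on a set of length \<open>1/m\<close>: on the
  interval \<open>(k/m, (k+1)/m]\<close> for \<open>block_coord m k\<close>, and on the comb \<open>X\<^sub>k\<close> consisting of the intervals
  \<open>((i * m + k)/m\<^sup>2, (i * m + k + 1)/m\<^sup>2]\<close> with \<open>i < m\<close> for \<open>comb_coord m k\<close>.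
\<close>
definition block_coord :: "nat \<Rightarrow> nat \<Rightarrow> real \<Rightarrow> real" where
  "block_coord m k u = unit_clamp (real m * u - real k)"

definition comb_coord :: "nat \<Rightarrow> nat \<Rightarrow> real \<Rightarrow> real" where
  "comb_coord m k u = (\<Sum>i<m. unit_clamp (real (m * m) * u - real (i * m + k))) / real m"

lemma quasi_copula_block_average:
  assumes "quasi_copula Q" "m > 0"
  shows "quasi_copula (average_pullback m (block_coord m) Q)"
proof (rule quasi_copula_average_pullback[OF assms])
  fix u :: real assume "u \<in> {0..1}"
  then have "real m * u \<le> real m" "0 \<le> real m * u"
    using mult_left_mono[of u 1 "real m"] by auto
  then show "(\<Sum>k<m. block_coord m k u) = real m * u"
    using sum_unit_clamp[of "real m * u" m] by (simp add: block_coord_def)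
next
  fix k u u' assume "u \<le> (u'::real)"
  then show "block_coord m k u \<le> block_coord m k u'"
    unfolding block_coord_def by (intro unit_clamp_mono diff_right_mono mult_left_mono) auto
qed (auto simp: block_coord_def unit_clamp_range, simp add: unit_clamp_def)

lemma comb_coord_range: "comb_coord m k u \<in> {0..1}"
proof -
  have "(\<Sum>i<m. unit_clamp (real (m * m) * u - real (i * m + k))) \<le> (\<Sum>i<m. 1)"
    by (intro sum_mono unit_clamp_range)
  then show ?thesis
    unfolding comb_coord_def by (auto intro!: divide_nonneg_nonneg sum_nonneg unit_clamp_range divide_le_eq_1[THEN iffD2])
qed

lemma quasi_copula_comb_average:
  assumes "quasi_copula Q" "m > 0"
  shows "quasi_copula (average_pullback m (comb_coord m) Q)"
proof (rule quasi_copula_average_pullback[OF assms])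
  fix u :: real assume u: "u \<in> {0..1}"
  then have *: "real (m*m) * u \<le> real (m*m)" "0 \<le> real (m*m) * u"
    using mult_left_mono[of u 1 "real (m*m)"] by auto
  have "(\<Sum>k<m. comb_coord m k u) = (\<Sum>i<m. \<Sum>k<m. unit_clamp (real (m * m) * u - real (i * m + k))) / real m"
    unfolding comb_coord_def sum_divide_distrib[symmetric] by (subst sum.swap) (rule refl)
  also have "\<dots> = (\<Sum>p<m*m. unit_clamp (real (m * m) * u - real p)) / real m"
    by (simp only: sum_nat_blocks)
  also have "\<dots> = real m * u"
    using * assms(2) by (subst sum_unit_clamp) auto
  finally show "(\<Sum>k<m. comb_coord m k u) = real m * u" .
next
  fix k u u' assume "u \<le> (u'::real)"
  then show "comb_coord m k u \<le> comb_coord m k u'"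
    unfolding comb_coord_def
    by (intro divide_right_mono sum_mono unit_clamp_mono diff_right_mono mult_left_mono) auto
next
  fix k assume k: "k < m"
  have "unit_clamp (real (m * m) * 1 - real (i * m + k)) = 1" if "i < m" for i
  proof -
    have "Suc (i * m + k) \<le> Suc i * m" using k by simp
    also have "\<dots> \<le> m * m" using that by (intro mult_le_mono1) simp
    finally show ?thesis by (simp add: unit_clamp_def flip: of_nat_mult of_nat_add)
  qed
  then show "comb_coord m k 1 = 1"
    using assms(2) by (simp add: comb_coord_def)
qed (rule comb_coord_range)

text \<open>
  In units of a column, \<open>comb_coord m k\<close> fills the \<open>i\<close>-th column in its \<open>k\<close>-th subcolumn, whereas the
  identity fills it uniformly. Both fill it from \<open>0\<close> to \<open>1\<close>, so they differ only in the column that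
  contains the argument.
\<close>
lemma comb_coord_near_identity:
  assumes k: "k < m" and u: "u \<in> {0..1}"
  shows "\<bar>comb_coord m k u - u\<bar> \<le> 1 / real m"
proof -
  define s where "s = real m * u"
  have m: "m > 0" using k by simp
  have s: "0 \<le> s" "s \<le> real m"
    using u mult_left_mono[of u 1 "real m"] by (auto simp: s_def)
  define F where "F i = unit_clamp (real m * (s - real i) - real k) - unit_clamp (s - real i)" for i
  have "\<bar>\<Sum>i<m. F i\<bar> \<le> 1"
  proof (rule sum_at_most_one_term[where s = s])
    show "\<bar>F i\<bar> \<le> 1" for i
      unfolding F_def using unit_clamp_range[of "real m * (s - real i) - real k"]
        unit_clamp_range[of "s - real i"] by linarith
    fix i assume "F i \<noteq> 0"
    show "real i \<le> s \<and> s < real i + 1"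
    proof (rule ccontr)
      assume "\<not> ?thesis"
      then consider "s - real i \<le> 0" | "s - real i \<ge> 1" by linarith
      then show False
      proof cases
        case 1
        then have "real m * (s - real i) \<le> 0" by (simp add: mult_nonneg_nonpos)
        with 1 \<open>F i \<noteq> 0\<close> show False by (simp add: F_def unit_clamp_def)
      next
        case 2
        then have "real m * (s - real i) \<ge> real m" using m by simp
        moreover have "real m \<ge> real k + 1" using k by simp
        ultimately have "real m * (s - real i) - real k \<ge> 1" by linarith
        with 2 \<open>F i \<noteq> 0\<close> show False by (simp add: F_def unit_clamp_def)
      qed
    qed
  qed
  moreover have "(\<Sum>i<m. F i) = real m * (comb_coord m k u - u)"
  proof -
    have "(\<Sum>i<m. unit_clamp (s - real i)) = real m * u"
      using sum_unit_clamp[OF s(1), of m] s(2) by (simp add: s_def)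
    moreover have "(\<Sum>i<m. unit_clamp (real m * (s - real i) - real k)) = real m * comb_coord m k u"
      using m by (simp add: comb_coord_def s_def algebra_simps)
    ultimately show ?thesis by (simp add: F_def sum_subtractf right_diff_distrib)
  qed
  ultimately have "real m * \<bar>comb_coord m k u - u\<bar> \<le> 1"
    by (simp only: abs_mult abs_of_nat)
  then show ?thesis
    using m by (simp add: pos_le_divide_eq mult.commute)
qed

lemma comb_average_near:
  assumes Q: "quasi_copula Q" and m: "m > 0" and "u \<in> {0..1}" "v \<in> {0..1}"
  shows "\<bar>Q (u, v) - average_pullback m (comb_coord m) Q (u, v)\<bar> \<le> 2 / real m"
proof -
  have "\<bar>\<Sum>k<m. Q (u, v) - Q (comb_coord m k u, comb_coord m k v)\<bar>
      \<le> (\<Sum>k<m. \<bar>Q (u, v) - Q (comb_coord m k u, comb_coord m k v)\<bar>)"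
    by (rule sum_abs)
  also have "\<dots> \<le> (\<Sum>k<m. 1 / real m + 1 / real m)"
  proof (rule sum_mono)
    fix k assume "k \<in> {..<m}"
    then have "\<bar>comb_coord m k u - u\<bar> \<le> 1 / real m" "\<bar>comb_coord m k v - v\<bar> \<le> 1 / real m"
      using comb_coord_near_identity assms(3,4) by auto
    then show "\<bar>Q (u, v) - Q (comb_coord m k u, comb_coord m k v)\<bar> \<le> 1 / real m + 1 / real m"
      using quasi_copulaD(6)[OF Q assms(3,4) comb_coord_range comb_coord_range, of m k u m k v] by linarith
  qed
  also have "\<dots> = 2" using m by simp
  also have "(\<Sum>k<m. Q (u, v) - Q (comb_coord m k u, comb_coord m k v))
      = real m * (Q (u, v) - average_pullback m (comb_coord m) Q (u, v))"
    using m by (simp add: sum_subtractf average_pullback_def right_diff_distrib)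
  finally show ?thesis
    using m by (simp only: abs_mult abs_of_nat) (simp add: pos_le_divide_eq mult.commute)
qed

text \<open>
  \<open>M\<close> is reproduced by its own block average, and \<open>Q\<close> agrees with \<open>min\<close> on the boundary of the unit
  square. So a block contributes to the error only if both coordinates are in its interior; there
  the smaller coordinate determines the block.
\<close>
lemma block_average_near_M:
  assumes Q: "quasi_copula Q" and m: "m > 0" and uv: "u \<in> {0..1}" "v \<in> {0..1}"
  shows "\<bar>M_copula (u, v) - average_pullback m (block_coord m) Q (u, v)\<bar> \<le> 1 / real m"
proof -
  define h where "h = block_coord m"
  define F where "F k = min (h k u) (h k v) - Q (h k u, h k v)" for k
  have h: "h k w \<in> {0..1}" for k w
    by (auto simp: h_def block_coord_def unit_clamp_range)
  have "min (real m * u) (real m * v) \<le> real m"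
    using uv mult_left_mono[of u 1 "real m"] by auto
  moreover have hm: "min (h k u) (h k v) = unit_clamp (min (real m * u) (real m * v) - real k)" for k
    by (auto simp: h_def block_coord_def unit_clamp_def)
  ultimately have summin: "(\<Sum>k<m. min (h k u) (h k v)) = real m * min u v"
    using sum_unit_clamp[of "min (real m * u) (real m * v)" m] uv
    by (simp add: min_mult_distrib_left)
  have "\<bar>\<Sum>k<m. F k\<bar> \<le> 1"
  proof (rule sum_at_most_one_term[where s = "min (real m * u) (real m * v)"])
    fix k
    show "\<bar>F k\<bar> \<le> 1"
      using h[of k u] h[of k v] quasi_copulaD(1)[OF Q h h, of k u k v] by (auto simp: F_def)
    assume "F k \<noteq> 0"
    have "h k u \<noteq> 0" "h k v \<noteq> 0" "h k u \<noteq> 1" "h k v \<noteq> 1"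
      using \<open>F k \<noteq> 0\<close> h[of k u] h[of k v] quasi_copula_zero[OF Q h] quasi_copulaD(2,3)[OF Q h]
      by (auto simp: F_def)
    then show "real k \<le> min (real m * u) (real m * v) \<and> min (real m * u) (real m * v) < real k + 1"
      by (auto simp: h_def block_coord_def unit_clamp_def min_def max_def split: if_splits)
  qed
  moreover have "(\<Sum>k<m. F k) = real m * (M_copula (u, v) - average_pullback m h Q (u, v))"
    using m summin by (simp add: F_def sum_subtractf M_copula_def average_pullback_def right_diff_distrib)
  ultimately have "real m * \<bar>M_copula (u, v) - average_pullback m h Q (u, v)\<bar> \<le> 1"
    by (simp only: abs_mult abs_of_nat)
  then show ?thesis
    using m by (simp add: h_def pos_le_divide_eq mult.commute)
qed

section \<open>The induced measure on disjoint boxes\<close>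

lemma induced_signed_measure_qc_measure: "induced_signed_measure Q (qc_measure Q)"
  unfolding qc_measure_def using theI'[OF ex1_induced_signed_measure[of Q]] by blast

lemma qc_measure_disjoint_boxes:
  assumes "finite I" and "\<And>i. i \<in> I \<Longrightarrow> R i \<in> half_open_boxes" and "disjoint_family_on R I"
  shows "(\<Union>i\<in>I. R i) \<in> box_algebra \<and> qc_measure Q (\<Union>i\<in>I. R i) = (\<Sum>i\<in>I. qc_measure Q (R i))"
  using assms
proof (induction I rule: finite_induct)
  case empty
  have e: "{} \<in> box_algebra" by (auto simp: box_algebra_def)
  then have "qc_measure Q ({} \<union> {}) = qc_measure Q {} + qc_measure Q {}"
    using induced_signed_measure_qc_measure[of Q] unfolding induced_signed_measure_def by blast
  then show ?case using e by simp
next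
  case (insert i I)
  let ?U = "\<Union>j\<in>I. R j"
  have fam: "disjoint_family_on R I"
    using insert.prems(2) by (rule disjoint_family_on_mono[rotated]) auto
  then have IH: "?U \<in> box_algebra" "qc_measure Q ?U = (\<Sum>i\<in>I. qc_measure Q (R i))"
    using insert by auto
  have Ri: "R i \<in> box_algebra"
    using insert.prems(1) half_open_boxes_subset by auto
  have disj: "R i \<inter> ?U = {}"
    using insert.prems(2) insert.hyps(2) by (auto simp: disjoint_family_on_def)
  have "disjoint (R ` insert i I)"
    using insert.prems(2) by (rule disjoint_family_on_disjoint_image)
  then have "R i \<union> ?U \<in> box_algebra"
    unfolding box_algebra_def mem_Collect_eq using insert.hyps(1) insert.prems(1)
    by (intro exI[of _ "R ` insert i I"]) auto
  moreover have "qc_measure Q (R i \<union> ?U) = qc_measure Q (R i) + qc_measure Q ?U"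
    using induced_signed_measure_qc_measure[of Q] Ri IH(1) disj
    unfolding induced_signed_measure_def by blast
  ultimately show ?case using IH insert.hyps by simp
qed

lemma qc_measure_grid:
  fixes \<alpha> \<beta> \<gamma> \<delta> :: "nat \<Rightarrow> real"
  assumes "\<And>i. i < n \<Longrightarrow> 0 \<le> \<alpha> i \<and> \<alpha> i \<le> \<beta> i \<and> \<beta> i \<le> 1"
    and "\<And>i. i < n \<Longrightarrow> 0 \<le> \<gamma> i \<and> \<gamma> i \<le> \<delta> i \<and> \<delta> i \<le> 1"
    and "disjoint_family_on (\<lambda>i. {\<alpha> i<..\<beta> i}) {..<n}"
    and "disjoint_family_on (\<lambda>i. {\<gamma> i<..\<delta> i}) {..<n}"
  shows "qc_measure Q ((\<Union>i<n. {\<alpha> i<..\<beta> i}) \<times> (\<Union>j<n. {\<gamma> j<..\<delta> j})) =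
    (\<Sum>i<n. \<Sum>j<n. Q (\<beta> i, \<delta> j) - Q (\<alpha> i, \<delta> j) - Q (\<beta> i, \<gamma> j) + Q (\<alpha> i, \<gamma> j))"
proof -
  let ?R = "\<lambda>(i, j). {\<alpha> i<..\<beta> i} \<times> {\<gamma> j<..\<delta> j}"
  have eq: "(\<Union>i<n. {\<alpha> i<..\<beta> i}) \<times> (\<Union>j<n. {\<gamma> j<..\<delta> j}) = (\<Union>p\<in>{..<n} \<times> {..<n}. ?R p)"
    by force
  have "disjoint_family_on ?R ({..<n} \<times> {..<n})"
    unfolding disjoint_family_on_def
  proof (intro ballI impI)
    fix p q assume pq: "p \<in> {..<n} \<times> {..<n}" "q \<in> {..<n} \<times> {..<n}" "p \<noteq> q"
    obtain i j i' j' where [simp]: "p = (i, j)" "q = (i', j')" by fastforce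
    have "i \<noteq> i' \<Longrightarrow> {\<alpha> i<..\<beta> i} \<inter> {\<alpha> i'<..\<beta> i'} = {}"
      "j \<noteq> j' \<Longrightarrow> {\<gamma> j<..\<delta> j} \<inter> {\<gamma> j'<..\<delta> j'} = {}"
      using assms(3,4) pq unfolding disjoint_family_on_def by auto
    then show "?R p \<inter> ?R q = {}"
      using pq(3) by (auto simp only: prod.case Times_Int_Times \<open>p = _\<close> \<open>q = _\<close>)
  qed
  moreover have "?R p \<in> half_open_boxes" if "p \<in> {..<n} \<times> {..<n}" for p
    using that assms(1)[of "fst p"] assms(2)[of "snd p"]
    unfolding half_open_boxes_def case_prod_unfold mem_Collect_eq mem_Times_iff lessThan_iff by blast
  ultimately have "qc_measure Q (\<Union>p\<in>{..<n} \<times> {..<n}. ?R p) = (\<Sum>p\<in>{..<n} \<times> {..<n}. qc_measure Q (?R p))"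
    using qc_measure_disjoint_boxes[of "{..<n} \<times> {..<n}" ?R Q] by blast
  also have "\<dots> = (\<Sum>i<n. \<Sum>j<n. qc_measure Q ({\<alpha> i<..\<beta> i} \<times> {\<gamma> j<..\<delta> j}))"
    by (simp add: sum.cartesian_product case_prod_unfold)
  also have "\<dots> = (\<Sum>i<n. \<Sum>j<n. Q (\<beta> i, \<delta> j) - Q (\<alpha> i, \<delta> j) - Q (\<beta> i, \<gamma> j) + Q (\<alpha> i, \<gamma> j))"
    using induced_signed_measure_qc_measure[of Q] assms(1,2) unfolding induced_signed_measure_def
    by (intro sum.cong refl) auto
  finally show ?thesis unfolding eq .
qed

section \<open>Shuffling equal pieces\<close>

text \<open>
  As \<open>\<pi>\<close> is a bijection, exactly \<open>\<pi> (Suc p) - 1\<close> pieces are moved in front of the piece number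
  \<open>Suc p\<close>, each of length \<open>1/n\<close>.
\<close>
lemma shuffle_map_equal_pieces:
  assumes \<pi>: "\<pi> permutes {1..n}" and p: "p < n"
    and t: "real p / real n < t" "t \<le> real (Suc p) / real n"
  shows "shuffle_map n (\<lambda>i. real i / real n) \<pi> t = t - real p / real n + real (\<pi> (Suc p) - 1) / real n"
proof -
  let ?a = "\<lambda>i. real i / real n"
  have n: "n > 0" using p by simp
  have "0 \<le> real p / real n" by simp
  then have "t > 0" using t(1) by linarith
  have the: "(THE i. i \<in> {1..n} \<and> t \<in> piece ?a i) = Suc p"
  proof (rule the_equality)
    show "Suc p \<in> {1..n} \<and> t \<in> piece ?a (Suc p)" using p t by (auto simp: piece_def)
    fix i assume i: "i \<in> {1..n} \<and> t \<in> piece ?a i"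
    then have "real (i - 1) / real n < t" "t \<le> real i / real n"
      unfolding piece_def greaterThanAtMost_iff by blast+
    then have "real (i - 1) / real n < real (Suc p) / real n" "real p / real n < real i / real n"
      using t by linarith+
    then have "i - 1 < Suc p" "p < i"
      using n by (simp_all only: divide_less_cancel of_nat_less_iff of_nat_0_less_iff)
    then show "i = Suc p" by linarith
  qed
  have "(\<Sum>j | j \<in> {1..n} \<and> \<pi> j < \<pi> (Suc p). measure lborel (piece ?a j))
      = (\<Sum>j | j \<in> {1..n} \<and> \<pi> j < \<pi> (Suc p). 1 / real n)"
  proof (rule sum.cong[OF refl])
    fix j assume "j \<in> {j. j \<in> {1..n} \<and> \<pi> j < \<pi> (Suc p)}"
    then have "real (j - 1) = real j - 1" by (simp add: of_nat_diff)
    then show "measure lborel (piece ?a j) = 1 / real n"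
      by (simp add: piece_def diff_divide_distrib)
  qed
  also have "\<dots> = real (card {j \<in> {1..n}. \<pi> j < \<pi> (Suc p)}) / real n"
    by simp
  also have "card {j \<in> {1..n}. \<pi> j < \<pi> (Suc p)} = card (\<pi> ` {j \<in> {1..n}. \<pi> j < \<pi> (Suc p)})"
    by (rule card_image[symmetric]) (rule inj_on_subset[OF permutes_inj[OF \<pi>] subset_UNIV])
  also have "\<pi> ` {j \<in> {1..n}. \<pi> j < \<pi> (Suc p)} = {1..<\<pi> (Suc p)}"
  proof -
    have "\<pi> ` {j \<in> {1..n}. \<pi> j < \<pi> (Suc p)} = {y \<in> \<pi> ` {1..n}. y < \<pi> (Suc p)}"
      by blast
    also have "\<dots> = {y \<in> {1..n}. y < \<pi> (Suc p)}"
      by (simp only: permutes_image[OF \<pi>])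
    also have "\<dots> = {1..<\<pi> (Suc p)}"
    proof -
      have "Suc p \<in> {1..n}" using p by simp
      then have "\<pi> (Suc p) \<in> {1..n}" by (simp only: permutes_in_image[OF \<pi>])
      then show ?thesis by auto
    qed
    finally show ?thesis .
  qed
  also have "card {1..<\<pi> (Suc p)} = \<pi> (Suc p) - 1" by simp
  finally show ?thesis
    using \<open>t > 0\<close> unfolding shuffle_map_def the by (simp add: Let_def)
qed

text \<open>
  On each piece the shuffle map is a translation, so the preimage meets the piece in an initial
  segment; the clamp covers the cases that this segment is empty or the whole piece.
\<close>
lemma shuffle_preimage_equal_pieces:
  assumes \<pi>: "\<pi> permutes {1..n}" and n: "n > 0"
  shows "{t \<in> {0..1}. shuffle_map n (\<lambda>i. real i / real n) \<pi> t \<in> {0<..x}} =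
    (\<Union>p<n. {real p / real n <..
       (real p + unit_clamp (real n * x - real (\<pi> (Suc p) - 1))) / real n})" (is "?L = ?R")
proof -
  let ?\<phi> = "shuffle_map n (\<lambda>i. real i / real n) \<pi>"
  have key: "?\<phi> t \<in> {0<..x} \<longleftrightarrow>
      t \<le> (real p + unit_clamp (real n * x - real (\<pi> (Suc p) - 1))) / real n"
    if p: "p < n" and t: "real p / real n < t" "t \<le> real (Suc p) / real n" for p t
  proof -
    define q where "q = real (\<pi> (Suc p) - 1)"
    have "?\<phi> t = t - real p / real n + q / real n"
      unfolding q_def by (rule shuffle_map_equal_pieces[OF \<pi> p t])
    moreover have "q / real n \<ge> 0" by (simp add: q_def)
    ultimately have "?\<phi> t \<in> {0<..x} \<longleftrightarrow> t - real p / real n + q / real n \<le> x"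
      using t(1) by auto
    also have "\<dots> \<longleftrightarrow> real n * (t - real p / real n + q / real n) \<le> real n * x"
      using n by simp
    also have "real n * (t - real p / real n + q / real n) = real n * t - real p + q"
      using n by (simp add: distrib_left right_diff_distrib)
    also have "real n * t - real p + q \<le> real n * x \<longleftrightarrow> real n * t - real p \<le> real n * x - q"
      by linarith
    also have "\<dots> \<longleftrightarrow> real n * t - real p \<le> unit_clamp (real n * x - q)"
    proof -
      have "0 < real n * t - real p" "real n * t - real p \<le> 1"
        using t n by (simp_all add: field_simps)
      then show ?thesis unfolding unit_clamp_def by linarith
    qed
    also have "\<dots> \<longleftrightarrow> t \<le> (real p + unit_clamp (real n * x - q)) / real n"
      using n by (simp add: pos_le_divide_eq mult.commute diff_le_eq add.commute)
    finally show ?thesis unfolding q_def .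
  qed
  show ?thesis
  proof (intro equalityI subsetI)
    fix t assume t: "t \<in> ?L"
    have "?\<phi> 0 = 0" by (simp add: shuffle_map_def)
    then have "t \<noteq> 0" using t by (metis (no_types, lifting) greaterThanAtMost_iff less_irrefl mem_Collect_eq)
    define p where "p = nat (\<lceil>real n * t\<rceil> - 1)"
    have "0 < real n * t" using t \<open>t \<noteq> 0\<close> n by simp
    then have "\<lceil>real n * t\<rceil> \<ge> 1" by simp
    then have rp: "real p = of_int \<lceil>real n * t\<rceil> - 1" by (simp add: p_def)
    then have p1: "real p < real n * t" and p2: "real n * t \<le> real p + 1"
      by linarith+
    have "real n * t \<le> real n" using t n by simp
    then have p: "p < n" using p1 by linarith
    have pt: "real p / real n < t" "t \<le> real (Suc p) / real n"
      using p1 p2 n by (simp_all add: field_simps)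
    show "t \<in> ?R"
      using key[OF p pt] t p pt by auto
  next
    fix t assume "t \<in> ?R"
    then obtain p where p: "p < n" "real p / real n < t"
      and tu: "t \<le> (real p + unit_clamp (real n * x - real (\<pi> (Suc p) - 1))) / real n"
      by auto
    have "(real p + unit_clamp (real n * x - real (\<pi> (Suc p) - 1))) / real n \<le> real (Suc p) / real n"
      using unit_clamp_range by (intro divide_right_mono) auto
    with tu have up: "t \<le> real (Suc p) / real n" by linarith
    also have "\<dots> \<le> 1" using p(1) by simp
    finally have "t \<le> 1" .
    moreover have "0 \<le> real p / real n" by simp
    then have "0 \<le> t" using p(2) by linarith
    ultimately show "t \<in> ?L" using key[OF p up] tu by simp
  qed
qed

section \<open>The transposing shuffle\<close>

text \<open>
  Counted from \<open>0\<close>, this exchanges the two base-\<open>m\<close> digits of the index; the shift by \<open>Suc\<close> comes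
  from pieces being numbered from \<open>1\<close>.
\<close>
definition transpose_perm :: "nat \<Rightarrow> nat \<Rightarrow> nat" where
  "transpose_perm m t =
     (if t \<in> {1..m * m} then Suc ((t - 1) mod m * m + (t - 1) div m) else t)"

lemma block_index_less:
  assumes "k < m" "i < (m::nat)" shows "k * m + i < m * m"
proof -
  have "k * m + i < Suc k * m" using assms(2) by simp
  also have "\<dots> \<le> m * m" using assms(1) by (intro mult_le_mono1) simp
  finally show ?thesis .
qed

lemma transpose_perm_index:
  assumes "k < m" "i < m"
  shows "transpose_perm m (Suc (k * m + i)) = Suc (i * m + k)"
  using block_index_less[OF assms] assms by (simp add: transpose_perm_def)

lemma transpose_perm_permutes: "transpose_perm m permutes {1..m * m}"
proof -
  have inv: "transpose_perm m t \<in> {1..m * m} \<and> transpose_perm m (transpose_perm m t) = t"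
    if t: "t \<in> {1..m * m}" for t
  proof -
    have m: "m > 0" using t by (cases m) auto
    define k i where "k = (t - 1) div m" and "i = (t - 1) mod m"
    have "k * m + i = t - 1" by (simp add: k_def i_def)
    then have eq: "t = Suc (k * m + i)" using t by simp
    have ki: "k < m" "i < m"
      using t m by (auto simp: k_def i_def less_mult_imp_div_less)
    show ?thesis
      using ki block_index_less[OF ki(2,1)] by (simp add: eq transpose_perm_index)
  qed
  show ?thesis
  proof (rule bij_imp_permutes)
    show "bij_betw (transpose_perm m) {1..m * m} {1..m * m}"
      by (rule bij_betw_byWitness[where f' = "transpose_perm m"]) (use inv in auto)
  qed (auto simp: transpose_perm_def)
qed

text \<open>
  Write \<open>p = l * m + i\<close>. The block coordinate is constant on the piece unless \<open>l = k\<close>, so only the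
  pieces of the \<open>k\<close>-th block count. They are sent to the \<open>k\<close>-th subcolumns of the columns
  \<open>i = 0, 1, \<dots>\<close>, which the interval from \<open>0\<close> to \<open>x\<close> covers in this order; hence the staircase.
  Since \<open>f\<close> is arbitrary, the identity can be applied to each variable of \<open>Q\<close> in turn.
\<close>
lemma block_telescope:
  fixes f :: "real \<Rightarrow> real"
  assumes k: "k < m"
  shows "(\<Sum>p<m*m. f (block_coord m k
            ((real p + unit_clamp (real (m*m) * x - real (transpose_perm m (Suc p) - 1))) / real (m*m)))
          - f (block_coord m k (real p / real (m*m))))
       = f (comb_coord m k x) - f 0"
proof -
  define z where "z i = unit_clamp (real (m*m) * x - real (i*m + k))" for i
  have m: "m > 0" using k by simp
  \<comment> \<open>With \<open>c = 0\<close> this evaluates the left end of a piece, with a clamp for \<open>c\<close> the right end.\<close>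
  have coord: "block_coord m k ((real (l * m + i) + c) / real (m*m)) =
      (if l = k then (real i + c) / real m else if l < k then 0 else 1)"
    if "i < m" "c \<in> {0..1}" for l i c
  proof -
    have ic: "0 \<le> (real i + c) / real m" "(real i + c) / real m \<le> 1"
      using that m by auto
    have "real m * ((real (l * m + i) + c) / real (m*m)) - real k
        = (real l - real k) + (real i + c) / real m"
      using m by (simp add: field_simps)
    moreover have "l < k \<Longrightarrow> real l - real k \<le> -1" "l > k \<Longrightarrow> real l - real k \<ge> 1"
      by linarith+
    ultimately show ?thesis
      using ic unfolding block_coord_def unit_clamp_def by (auto simp del: of_nat_mult of_nat_add)
  qed
  let ?c = "\<lambda>l i. unit_clamp (real (m*m) * x - real (transpose_perm m (Suc (l*m+i)) - 1))"
  let ?T = "\<lambda>l i. f (block_coord m k ((real (l*m+i) + ?c l i) / real (m*m)))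
          - f (block_coord m k (real (l*m+i) / real (m*m)))"
  have c: "?c l i \<in> {0..1}" for l i
    by (simp add: unit_clamp_range)
  have T: "?T l i = (if l = k then f ((real i + z i) / real m) - f (real i / real m) else 0)"
    if "l < m" "i < m" for l i
  proof -
    have "?c l i = unit_clamp (real (m*m) * x - real (i * m + l))"
      by (simp only: transpose_perm_index[OF that] diff_Suc_1)
    then show ?thesis
      using coord[OF that(2) c, of l l i] coord[OF that(2), of 0 l]
      by (auto simp: z_def simp del: of_nat_mult of_nat_add)
  qed
  have "(\<Sum>l<m. \<Sum>i<m. ?T l i) = (\<Sum>l<m. if l = k then (\<Sum>i<m. f ((real i + z i) / real m) - f (real i / real m)) else 0)"
  proof (rule sum.cong[OF refl])
    fix l assume "l \<in> {..<m}"
    then have "(\<Sum>i<m. ?T l i) = (\<Sum>i<m. if l = k then f ((real i + z i) / real m) - f (real i / real m) else 0)"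
      by (intro sum.cong[OF refl] T) auto
    also have "\<dots> = (if l = k then (\<Sum>i<m. f ((real i + z i) / real m) - f (real i / real m)) else 0)"
      by simp
    finally show "(\<Sum>i<m. ?T l i) = (if l = k then (\<Sum>i<m. f ((real i + z i) / real m) - f (real i / real m)) else 0)" .
  qed
  also have "\<dots> = (\<Sum>i<m. f ((real i + z i) / real m) - f (real i / real m))"
    using k by (simp add: sum.delta)
  also have "\<dots> = f ((\<Sum>i<m. z i) / real m) - f (0 / real m)"
  proof (rule sum_staircase_telescope)
    show "z i \<in> {0..1}" for i by (simp add: z_def unit_clamp_range)
    show "z i = 1" if "z (Suc i) > 0" for i
    proof -
      have "real (m*m) * x - real (Suc i * m + k) > 0"
        using that by (auto simp: z_def unit_clamp_def max_def min_def split: if_splits)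
      moreover have "real (Suc i * m + k) \<ge> real (i * m + k) + 1"
        using m by simp
      ultimately show ?thesis by (simp add: z_def unit_clamp_def)
    qed
  qed
  also have "(\<Sum>i<m. z i) / real m = comb_coord m k x"
    by (simp only: z_def comb_coord_def)
  finally show ?thesis
    by (subst sum_nat_blocks) simp
qed

lemma comb_average_is_shuffle:
  assumes Q: "quasi_copula Q" and m: "m > 0"
  shows "is_shuffle (average_pullback m (comb_coord m) Q) (average_pullback m (block_coord m) Q)"
proof -
  define n where "n = m * m"
  have n: "n > 0" using m by (simp add: n_def)
  define a where "a = (\<lambda>i. real i / real n)"
  define \<pi> where "\<pi> = transpose_perm m"
  let ?A = "average_pullback m (comb_coord m) Q"
  let ?B = "average_pullback m (block_coord m) Q"
  let ?g = "comb_coord m" and ?h = "block_coord m"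
  have \<pi>: "\<pi> permutes {1..n}" unfolding \<pi>_def n_def by (rule transpose_perm_permutes)
  have part: "interval_partition n a"
    using n by (auto simp: interval_partition_def a_def divide_right_mono)
  define c where "c x p = (real p + unit_clamp (real n * x - real (\<pi> (Suc p) - 1))) / real n" for x p
  have le: "0 \<le> a p \<and> a p \<le> c x p \<and> c x p \<le> 1" if "p < n" for x p
  proof -
    have "real p + unit_clamp (real n * x - real (\<pi> (Suc p) - 1)) \<le> real n"
      using that unit_clamp_range(2)[of "real n * x - real (\<pi> (Suc p) - 1)"] by linarith
    then show ?thesis
      using n by (auto simp: a_def c_def unit_clamp_range intro!: divide_right_mono)
  qed
  have csuc: "c x p \<le> a (Suc p)" for x p
    unfolding a_def c_def using unit_clamp_range by (intro divide_right_mono) auto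
  have amono: "a i \<le> a j" if "i \<le> j" for i j
    unfolding a_def using that by (intro divide_right_mono) auto
  have disj: "disjoint_family_on (\<lambda>p. {a p<..c x p}) {..<n}" for x
  proof -
    have "{a i<..c x i} \<inter> {a j<..c x j} = {}" if "i < j" for i j
      using order_trans[OF csuc[of x i] amono[of "Suc i" j]] that by auto
    then show ?thesis
      unfolding disjoint_family_on_def by (metis Int_commute linorder_neqE_nat)
  qed
  have "?A (x, y) = qc_measure ?B {(t1, t2) \<in> unit_square.
      (shuffle_map n a \<pi> t1, shuffle_map n a \<pi> t2) \<in> {0<..x} \<times> {0<..y}}" for x y
  proof -
    have "{(t1, t2) \<in> unit_square. (shuffle_map n a \<pi> t1, shuffle_map n a \<pi> t2) \<in> {0<..x} \<times> {0<..y}}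
        = {t \<in> {0..1}. shuffle_map n a \<pi> t \<in> {0<..x}} \<times> {t \<in> {0..1}. shuffle_map n a \<pi> t \<in> {0<..y}}"
      by blast
    also have "\<dots> = (\<Union>p<n. {a p<..c x p}) \<times> (\<Union>p<n. {a p<..c y p})"
      unfolding a_def c_def shuffle_preimage_equal_pieces[OF \<pi> n] ..
    finally have "qc_measure ?B {(t1, t2) \<in> unit_square.
        (shuffle_map n a \<pi> t1, shuffle_map n a \<pi> t2) \<in> {0<..x} \<times> {0<..y}} =
        (\<Sum>p<n. \<Sum>q<n. ?B (c x p, c y q) - ?B (a p, c y q) - ?B (c x p, a q) + ?B (a p, a q))"
      by (simp only: qc_measure_grid[where \<alpha> = a and \<beta> = "c x" and \<gamma> = a and \<delta> = "c y", OF le le disj disj])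
    \<comment> \<open>Group the four corners as a difference in the first variable of differences in the second.\<close>
    also have "\<dots> = (\<Sum>p<n. \<Sum>q<n. (\<Sum>k<m.
        (Q (?h k (c x p), ?h k (c y q)) - Q (?h k (c x p), ?h k (a q)))
        - (Q (?h k (a p), ?h k (c y q)) - Q (?h k (a p), ?h k (a q)))) / real m)"
      by (intro sum.cong refl)
         (simp add: average_pullback_def sum_subtractf sum.distrib add_divide_distrib diff_divide_distrib)
    also have "\<dots> = (\<Sum>k<m. \<Sum>p<n. \<Sum>q<n.
        (Q (?h k (c x p), ?h k (c y q)) - Q (?h k (c x p), ?h k (a q)))
        - (Q (?h k (a p), ?h k (c y q)) - Q (?h k (a p), ?h k (a q)))) / real m"
      unfolding sum_divide_distrib[symmetric]
      by (rule arg_cong[where f = "\<lambda>s. s / real m"], rule sum_rotate)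
    also have "\<dots> = (\<Sum>k<m. Q (?g k x, ?g k y)) / real m"
    proof (rule arg_cong[where f = "\<lambda>s. s / real m"], rule sum.cong[OF refl])
      fix k assume "k \<in> {..<m}"
      then have tele: "(\<Sum>p<n. f (?h k (c x p)) - f (?h k (a p))) = f (?g k x) - f 0"
        for f :: "real \<Rightarrow> real" and x
        using block_telescope[of k m f] unfolding n_def c_def a_def \<pi>_def by simp
      have "(\<Sum>p<n. \<Sum>q<n.
          (Q (?h k (c x p), ?h k (c y q)) - Q (?h k (c x p), ?h k (a q)))
          - (Q (?h k (a p), ?h k (c y q)) - Q (?h k (a p), ?h k (a q))))
        = (\<Sum>p<n. (Q (?h k (c x p), ?g k y) - Q (?h k (c x p), 0))
          - (Q (?h k (a p), ?g k y) - Q (?h k (a p), 0)))"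
        by (intro sum.cong refl, subst sum_subtractf) (simp only: tele[where f = "\<lambda>t. Q (s, t)" for s])
      also have "\<dots> = (Q (?g k x, ?g k y) - Q (?g k x, 0)) - (Q (0, ?g k y) - Q (0, 0))"
        by (rule tele[where f = "\<lambda>s. Q (s, ?g k y) - Q (s, 0)"])
      also have "\<dots> = Q (?g k x, ?g k y)"
        using quasi_copula_zero[OF Q comb_coord_range] quasi_copula_zero[OF Q, of 0] by simp
      finally show "(\<Sum>p<n. \<Sum>q<n.
          (Q (?h k (c x p), ?h k (c y q)) - Q (?h k (c x p), ?h k (a q)))
          - (Q (?h k (a p), ?h k (c y q)) - Q (?h k (a p), ?h k (a q))))
        = Q (?g k x, ?g k y)" .
    qed
    finally show ?thesis by (simp add: average_pullback_def)
  qed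
  then show ?thesis
    unfolding is_shuffle_def using part \<pi> by blast
qed

lemma sup_norm_le:
  assumes "\<And>u v. u \<in> {0..1} \<Longrightarrow> v \<in> {0..1} \<Longrightarrow> \<bar>f (u, v)\<bar> \<le> b"
  shows "sup_norm f \<le> b"
  unfolding sup_norm_def by (rule cSUP_least) (use assms in auto)

theorem theorem9:
  fixes Q :: "real \<times> real \<Rightarrow> real" and \<epsilon> :: real
  assumes "quasi_copula Q" and "\<epsilon> > 0"
  shows "\<exists>A B. quasi_copula A \<and> quasi_copula B \<and>
           sup_norm (\<lambda>p. Q p - A p) < \<epsilon> \<and>
           sup_norm (\<lambda>p. M_copula p - B p) < \<epsilon> \<and>
           is_shuffle A B"
proof -
  obtain m where m: "real m > 2 / \<epsilon>" using reals_Archimedean2 by blast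
  moreover have "2 / \<epsilon> > 0" using assms(2) by simp
  ultimately have m0: "m > 0" by (cases m) auto
  have "2 / real m < \<epsilon>" using m m0 assms(2) by (simp add: field_simps)
  moreover have "1 / real m \<le> 2 / real m" by (simp add: divide_right_mono)
  ultimately have "2 / real m < \<epsilon>" "1 / real m < \<epsilon>" by linarith+
  then have "sup_norm (\<lambda>p. Q p - average_pullback m (comb_coord m) Q p) < \<epsilon>"
    "sup_norm (\<lambda>p. M_copula p - average_pullback m (block_coord m) Q p) < \<epsilon>"
    using sup_norm_le[where f = "\<lambda>p. Q p - average_pullback m (comb_coord m) Q p",
        OF comb_average_near[OF assms(1) m0]]
      sup_norm_le[where f = "\<lambda>p. M_copula p - average_pullback m (block_coord m) Q p",
        OF block_average_near_M[OF assms(1) m0]] by linarith+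
  then show ?thesis
    using quasi_copula_comb_average[OF assms(1) m0] quasi_copula_block_average[OF assms(1) m0]
      comb_average_is_shuffle[OF assms(1) m0] by blast
qed

end
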